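(* Let $\delta := 2\epsilon + \frac{2-\omega}{\omega}\min(\mathrm{diag}(\mathbf{D}))$ and let $\omega\in(0,2)$, $\epsilon\in[0,\infty)$ be chosen such that $\delta\in(0,\infty)$. Let $\mathbf{x}^*$ be any global minimizer of $f$. Consider the iteration (with step sizes $\alpha^k>0$) $$\mathbf{y}^k=\mathcal{T}(\mathbf{x}^k),\qquad \mathbf{x}^{k+1}=\mathbf{x}^k+\alpha^k\mathbf{B}(\mathbf{y}^k-\mathbf{x}^k),$$ and suppose $\mathbf{x}^k$ is not a minimizer of $f$. Put $$\mathbf{P}:=2\mathbf{B}^T\mathbf{B},\quad\mathbf{Q}:=2\mathbf{B}-\tfrac12\mathbf{A},\quad\mathbf{G}^k:=\tfrac12(\alpha^k)^2\mathbf{P}-\alpha^k\mathbf{Q}.$$ Then: (i) $\|\mathbf{x}^{k+1}-\mathbf{x}^*\|_2^2-\|\mathbf{x}^k-\mathbf{x}^*\|_2^2\le\|\mathbf{y}^k-\mathbf{x}^k\|_{\mathbf{G}^k}^2$. (ii) If $0<\alpha^k<\frac{\delta}{\|\mathbf{B}^T\mathbf{B}\|}$ (a global constant), then $\mathbf{G}^k\prec0$ and $\|\mathbf{x}^{k+1}-\mathbf{x}^*\|_2^2-\|\mathbf{x}^k-\mathbf{x}^*\|_2^2<0$. (iii) If $\alpha^k=\frac{\|\mathbf{y}^k-\mathbf{x}^k\|_{\mathbf{Q}}^2}{\|\mathbf{y}^k-\mathbf{x}^k\|_{\mathbf{P}}^2}$ (a local constant), then $\|\mathbf{x}^{k+1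}-\mathbf{x}^*\|_2^2-\|\mathbf{x}^k-\mathbf{x}^*\|_2^2\le-\frac{\delta^2\|\mathbf{y}^k-\mathbf{x}^k\|_2^2}{4\|\mathbf{B}\mathbf{B}^T\|}<0$.
   Context: Let $\mathbf{A}\in\mathbb{R}^{n\times n}$ be symmetric positive semidefinite, $\mathbf{b}\in\mathbb{R}^n$, $q(\mathbf{x})=\frac12\mathbf{x}^T\mathbf{A}\mathbf{x}+\mathbf{x}^T\mathbf{b}$, and let $h:\mathbb{R}^n\to\mathbb{R}$ be convex and separable, $h(\mathbf{x})=\sum_{i=1}^n h_i(\mathbf{x}_i)$. Put $f=q+h$, assumed bounded below. $\partial h$ is the convex subdifferential. $\|\cdot\|$ is the Euclidean norm for vectors and the spectral norm for matrices. For a (not necessarily symmetric) matrix $\mathbf{M}$, $\|\mathbf{v}\|_{\mathbf{M}}^2$ denotes $\mathbf{v}^T\mathbf{M}\mathbf{v}$, and $\mathbf{M}\prec0$ means $\mathbf{v}^T\mathbf{M}\mathbf{v}<0$ for all $\mathbf{v}\ne\mathbf{0}$. Let $\mathbf{D}$ be the diagonal part of $\mathbf{A}$ and $\mathbf{L}$ its strictly lower triangular part, so $\mathbf{A}=\mathbf{L}+\mathbf{D}+\mathbf{L}^T$; $\mathrm{diag}(\mathbf{D})$ is the vector of diagonal entries and $\min(\cdot)$ its smallest entry. Given $\omega\in(0,2)$ and $\epsilon\in[0,\infty)$ with all diagonal entries of $\mathbf{B}$ positive, set $\mathbf{B}=\mathbf{L}+\frac1\omega\mathbf{D}+\epsilon\mathbf{I}$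 and $\mathbf{C}=\mathbf{L}^T+\frac{\omega-1}{\omega}\mathbf{D}-\epsilon\mathbf{I}$, so $\mathbf{A}=\mathbf{B}+\mathbf{C}$. $\mathcal{T}(\mathbf{x})$ is the unique $\mathbf{z}$ with $\mathbf{0}\in\mathbf{B}\mathbf{z}+\mathbf{C}\mathbf{x}+\mathbf{b}+\partial h(\mathbf{z})$. *)

theory Defs
  imports "HOL-Analysis.Analysis"
begin

type_synonym 'n rvec = "(real, 'n) vec"
type_synonym 'n sqmat = "((real, 'n) vec, 'n) vec"

definition positive_semidefinite :: "real^'n^'n \<Rightarrow> bool" where
  "positive_semidefinite M \<longleftrightarrow> (\<forall>v. 0 \<le> v \<bullet> (M *v v))"

(* No symmetry is required of the matrix in the next two definitions. *)

definition negative_definite :: "real^'n^'n \<Rightarrow> bool" where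
  "negative_definite M \<longleftrightarrow> (\<forall>v. v \<noteq> 0 \<longrightarrow> v \<bullet> (M *v v) < 0)"

definition sq_norm_wrt :: "real^'n^'n \<Rightarrow> real^'n \<Rightarrow> real" where
  "sq_norm_wrt M v = v \<bullet> (M *v v)"

(* The norm on real^'n is Euclidean, so the induced operator norm is the spectral norm;
   the norm of the type real^'n^'n itself would be the Frobenius norm. *)
definition spectral_norm :: "real^'n^'m \<Rightarrow> real" where
  "spectral_norm M = onorm (\<lambda>v. M *v v)"

definition subdifferential :: "('a::real_inner \<Rightarrow> real) \<Rightarrow> 'a \<Rightarrow> 'a set" where
  "subdifferential h x = {g. \<forall>z. h x + g \<bullet> (z - x) \<le> h z}"

definition objective :: "real^'n^'n \<Rightarrow> real^'n \<Rightarrow> (real^'n \<Rightarrow> real) \<Rightarrow> real^'n \<Rightarrow> real" where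
  "objective A b h x = 1/2 * (x \<bullet> (A *v x)) + x \<bullet> b + h x"

definition diag_vec :: "real^'n^'n \<Rightarrow> real^'n" where
  "diag_vec M = (\<chi> i. M $ i $ i)"

definition diag_part :: "real^'n^'n \<Rightarrow> real^'n^'n" where
  "diag_part M = (\<chi> i j. if i = j then M $ i $ j else 0)"

(* Coordinates are ordered by the linear order of the index type. *)
definition strict_lower_part :: "('n::{finite,linorder}) sqmat \<Rightarrow> 'n sqmat" where
  "strict_lower_part M = (\<chi> i j. if j < i then M $ i $ j else 0)"

definition min_entry :: "real^'n \<Rightarrow> real" where
  "min_entry v = Min (range (\<lambda>i. v $ i))"

definition matB :: "('n::{finite,linorder}) sqmat \<Rightarrow> real \<Rightarrow> real \<Rightarrow> 'n sqmat" where
  "matB A \<omega> \<epsilon> = strict_lower_part A + (1 / \<omega>) *\<^sub>R diag_part A + \<epsilon> *\<^sub>R mat 1"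

definition matC :: "('n::{finite,linorder}) sqmat \<Rightarrow> real \<Rightarrow> real \<Rightarrow> 'n sqmat" where
  "matC A \<omega> \<epsilon> =
     transpose (strict_lower_part A) + ((\<omega> - 1) / \<omega>) *\<^sub>R diag_part A - \<epsilon> *\<^sub>R mat 1"

definition splitting_map ::
  "('n::{finite,linorder}) sqmat \<Rightarrow> 'n rvec \<Rightarrow> ('n rvec \<Rightarrow> real) \<Rightarrow> real \<Rightarrow> real \<Rightarrow> 'n rvec
     \<Rightarrow> 'n rvec" where
  "splitting_map A b h \<omega> \<epsilon> x =
     (THE z. 0 \<in> (\<lambda>g. matB A \<omega> \<epsilon> *v z + matC A \<omega> \<epsilon> *v x + b + g) ` subdifferential h z)"

definition matP :: "('n::{finite,linorder}) sqmat \<Rightarrow> real \<Rightarrow> real \<Rightarrow> 'n sqmat" where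
  "matP A \<omega> \<epsilon> = 2 *\<^sub>R (transpose (matB A \<omega> \<epsilon>) ** matB A \<omega> \<epsilon>)"

definition matQ :: "('n::{finite,linorder}) sqmat \<Rightarrow> real \<Rightarrow> real \<Rightarrow> 'n sqmat" where
  "matQ A \<omega> \<epsilon> = 2 *\<^sub>R matB A \<omega> \<epsilon> - (1 / 2) *\<^sub>R A"

definition matG :: "('n::{finite,linorder}) sqmat \<Rightarrow> real \<Rightarrow> real \<Rightarrow> real \<Rightarrow> 'n sqmat" where
  "matG A \<omega> \<epsilon> a = ((1 / 2) * a\<^sup>2) *\<^sub>R matP A \<omega> \<epsilon> - a *\<^sub>R matQ A \<omega> \<epsilon>"

definition splitting_delta :: "('n::{finite,linorder}) sqmat \<Rightarrow> real \<Rightarrow> real \<Rightarrow> real" where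
  "splitting_delta A \<omega> \<epsilon> =
     2 * \<epsilon> + (2 - \<omega>) / \<omega> * min_entry (diag_vec (diag_part A))"

end

theory Submission
  imports Defs
begin

text \<open>
  Write \<open>d = y - x\<close> for the residual at \<open>x = x k\<close>. The defining inclusion of \<open>y = T x\<close> says
  \<open>B d = - (A x + b + g)\<close> for some subgradient \<open>g\<close> of \<open>h\<close> at \<open>y\<close>, so \<open>B d\<close> is a kind of
  negative subgradient of the objective, with smooth part taken at \<open>x\<close> and nonsmooth part at \<open>y\<close>.
  Its use as a direction of motion rests on one inequality. Optimality of \<open>x*\<close> makes
  \<open>- (A x* + b)\<close> a subgradient of \<open>h\<close> at \<open>x*\<close>. Monotonicity of the subdifferential then gives
  \<open>\<langle>B d, y - x*\<rangle> \<le> - \<langle>A u, u + d\<rangle>\<close> with \<open>u = x - x*\<close>, and since \<open>A\<close> is positive semidefinite,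
  completing the square \<open>\<langle>A (u + d/2), u + d/2\<rangle> \<ge> 0\<close> bounds the right-hand side by
  \<open>\<langle>A d, d\<rangle> / 4\<close> (\<open>monotone_psd_pairing_bound\<close>), which no longer mentions \<open>x*\<close>. Hence
  \<open>2 \<langle>B d, x - x*\<rangle> \<le> - \<langle>d, Q d\<rangle>\<close>, and expanding \<open>|x + \<alpha> B d - x*|\<^sup>2\<close> yields (i)
  (\<open>distance_change_le_matG\<close>).

  Everything else is about the quadratic polynomial
  \<open>\<langle>d, G d\<rangle> = \<alpha>\<^sup>2 |B d|\<^sup>2 - \<alpha> \<langle>d, Q d\<rangle>\<close> in \<open>\<alpha>\<close>. Because \<open>L\<close> and its transpose have the same
  quadratic form, \<open>\<langle>d, Q d\<rangle> = \<langle>A d, d\<rangle>/2 + (2 - \<omega>)/\<omega> \<langle>D d, d\<rangle> + 2 \<epsilon> |d|\<^sup>2 \<ge> \<delta> |d|\<^sup>2\<close>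
  (\<open>splitting_delta_le_matQ\<close>). Combined with \<open>|B d|\<^sup>2 \<le> N |d|\<^sup>2\<close>, where \<open>N\<close> is the spectral norm
  of \<open>B\<^sup>T B\<close> or of \<open>B B\<^sup>T\<close>, this gives the sign of the polynomial for a small step, (ii), and its
  value \<open>- \<langle>d, Q d\<rangle>\<^sup>2 / (4 |B d|\<^sup>2)\<close> at the minimizing step, (iii). Strictness needs \<open>d \<noteq> 0\<close>: a
  fixed point of \<open>T\<close> satisfies the optimality condition and so minimizes the objective
  (\<open>objective_minimizer_iff\<close>).

  Finally, \<open>T\<close> is given by a definite description, so the inclusion for \<open>y\<close> is available only
  once the inclusion is known to have exactly one solution (\<open>splitting_map_inclusion\<close>).
  Uniqueness is strict monotonicity of \<open>B\<close>; existence is forward substitution along the lower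
  triangular \<open>B\<close>, each coordinate being a scalar strongly convex minimization
  (\<open>lower_triangular_inclusion_solvable\<close>).
\<close>

section \<open>Subgradients of a convex function\<close>

text \<open>The first-order optimality condition for a sum of a quadratic \<open>q\<close> and a convex \<open>h\<close>: on
  moving from \<open>z\<close> a fraction \<open>t\<close> of the way to \<open>w\<close>, the sum changes by at most
  \<open>t p + t\<^sup>2 m + t (h w - h z)\<close> by convexity, and by minimality this bound is nonnegative; divide by \<open>t\<close>
  and let \<open>t\<close> tend to \<open>0\<close>. Only the restriction
  of \<open>q\<close> to the line through \<open>z\<close> and \<open>w\<close> enters, so the same statement serves the scalar
  subproblems and the full objective.\<close>

lemma subgradient_inequality_at_minimizer:
  fixes h q :: "'a::real_vector \<Rightarrow> real"
  assumes convex: "convex_on UNIV h"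
    and minimal: "\<And>v. q z + h z \<le> q v + h v"
    and expansion: "\<And>t. q (z + t *\<^sub>R (w - z)) = q z + t * p + t\<^sup>2 * m"
  shows "h z - p \<le> h w"
proof -
  have bound: "0 \<le> (p + h w - h z) + t * m" if t: "0 < t" "t < 1" for t
  proof -
    have "h (z + t *\<^sub>R (w - z)) \<le> (1 - t) * h z + t * h w"
      using convex_onD[OF convex, of t z w] t by (simp add: algebra_simps)
    moreover have "q z + h z \<le> q z + t * p + t\<^sup>2 * m + h (z + t *\<^sub>R (w - z))"
      using minimal[of "z + t *\<^sub>R (w - z)"] expansion[of t] by simp
    ultimately have "0 \<le> t * ((p + h w - h z) + t * m)"
      by (simp add: algebra_simps power2_eq_square)
    then show ?thesis using t by (simp add: zero_le_mult_iff)
  qed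
  have "((\<lambda>t. (p + h w - h z) + t * m) \<longlongrightarrow> (p + h w - h z) + 0 * m) (at_right 0)"
    by (intro tendsto_intros)
  moreover have "\<forall>\<^sub>F t in at_right 0. 0 \<le> (p + h w - h z) + t * m"
    using bound by (auto simp: eventually_at_right_field intro: exI[of _ 1])
  ultimately have "0 \<le> (p + h w - h z) + 0 * m"
    by (intro tendsto_lowerbound) auto
  then show ?thesis by simp
qed

lemma subdifferential_monotone:
  assumes "g \<in> subdifferential h u" and "g' \<in> subdifferential h v"
  shows "0 \<le> (g - g') \<bullet> (u - v)"
proof -
  have "h u + g \<bullet> (v - u) \<le> h v" "h v + g' \<bullet> (u - v) \<le> h u"
    using assms by (auto simp: subdifferential_def)
  then show ?thesis by (simp add: inner_diff_left inner_diff_right)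
qed

text \<open>The solution is the minimizer of \<open>\<beta>/2 v\<^sup>2 + c v + f v\<close>. An affine minorant of \<open>f\<close> shows that
  outside \<open>[-R, R]\<close> this function is at least its value at \<open>0\<close>, so a minimum over that compact
  interval is a global one.\<close>

lemma scalar_resolvent_exists:
  fixes f :: "real \<Rightarrow> real"
  assumes convex: "convex_on UNIV f" and "0 < \<beta>"
  obtains z where "- (\<beta> * z + c) \<in> subdifferential f z"
proof -
  define s where "s = Inf ((\<lambda>t. (f 0 - f t) / (0 - t)) ` ({0<..} \<inter> UNIV))"
  have minorant: "f 0 + s * v \<le> f v" for v
    using convex_le_Inf_differential[OF convex, of 0 v] by (simp add: s_def)
  define q where "q v = \<beta> / 2 * v\<^sup>2 + c * v" for v
  \<comment> \<open>From \<open>\<bar>v\<bar> = R\<close> on, the quadratic term dominates the slope \<open>c + s\<close> of the linear minorant.\<close>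
  define R where "R = 2 * \<bar>c + s\<bar> / \<beta>"
  have "0 \<le> R" using \<open>0 < \<beta>\<close> by (simp add: R_def)
  have "continuous_on UNIV f"
    using convex_on_continuous[OF open_UNIV convex] .
  then have "continuous_on {-R..R} (\<lambda>v. q v + f v)"
    unfolding q_def by (intro continuous_intros) (auto intro: continuous_on_subset)
  moreover have "{-R..R} \<noteq> {}" using \<open>0 \<le> R\<close> by simp
  ultimately have "\<exists>z\<in>{-R..R}. \<forall>v\<in>{-R..R}. q z + f z \<le> q v + f v"
    by (intro continuous_attains_inf) auto
  then obtain z where z: "\<And>v. v \<in> {-R..R} \<Longrightarrow> q z + f z \<le> q v + f v" by blast
  have minimal: "q z + f z \<le> q v + f v" for v
  proof (cases "\<bar>v\<bar> \<le> R")
    case True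
    then show ?thesis by (intro z) auto
  next
    case False
    then have "\<bar>c + s\<bar> \<le> \<beta> / 2 * \<bar>v\<bar>"
      using \<open>0 < \<beta>\<close> by (simp add: R_def field_simps)
    then have "\<bar>c + s\<bar> * \<bar>v\<bar> \<le> \<beta> / 2 * \<bar>v\<bar> * \<bar>v\<bar>"
      by (intro mult_right_mono) auto
    then have "\<bar>(c + s) * v\<bar> \<le> \<beta> / 2 * v\<^sup>2"
      by (simp add: abs_mult power2_eq_square)
    then have "0 \<le> \<beta> / 2 * v\<^sup>2 + (c + s) * v" by linarith
    then have "q 0 + f 0 \<le> q v + (f 0 + s * v)"
      by (simp add: q_def algebra_simps)
    moreover have "q z + f z \<le> q 0 + f 0" using \<open>0 \<le> R\<close> by (intro z) auto
    ultimately show ?thesis using minorant[of v] by linarith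
  qed
  have "f z - (\<beta> * z + c) * (w - z) \<le> f w" for w
    by (rule subgradient_inequality_at_minimizer[OF convex minimal,
          where m = "\<beta> / 2 * (w - z)\<^sup>2"])
      (simp add: q_def power2_eq_square field_simps)
  then show ?thesis
    by (intro that[of z]) (simp add: subdifferential_def algebra_simps)
qed

section \<open>Inclusions with a separable subdifferential\<close>

text \<open>Restricted to a coordinate axis, a separable function is a single summand up to an additive
  constant, so each summand inherits convexity.\<close>

lemma convex_on_summand:
  fixes h :: "real^'n \<Rightarrow> real"
  assumes convex: "convex_on UNIV h" and separable: "\<And>v. h v = (\<Sum>j\<in>UNIV. \<phi> j (v $ j))"
  shows "convex_on UNIV (\<phi> i)"
proof -
  have section_eq: "\<phi> i s = h (axis i s) - (\<Sum>j\<in>UNIV - {i}. \<phi> j 0)" for s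
  proof -
    have "h (axis i s) = \<phi> i s + (\<Sum>j\<in>UNIV - {i}. \<phi> j (axis i s $ j))"
      using sum.remove[of UNIV i "\<lambda>j. \<phi> j (axis i s $ j)"] by (simp add: separable)
    also have "(\<Sum>j\<in>UNIV - {i}. \<phi> j (axis i s $ j)) = (\<Sum>j\<in>UNIV - {i}. \<phi> j 0)"
      by (intro sum.cong) (auto simp: axis_def)
    finally show ?thesis by simp
  qed
  show ?thesis
  proof (rule convex_onI)
    fix t s r :: real assume t: "0 < t" "t < 1"
    have "axis i ((1 - t) *\<^sub>R s + t *\<^sub>R r) = (1 - t) *\<^sub>R axis i s + t *\<^sub>R axis i r"
      by (simp add: vec_eq_iff axis_def)
    then have "h (axis i ((1 - t) *\<^sub>R s + t *\<^sub>R r)) \<le> (1 - t) * h (axis i s) + t * h (axis i r)"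
      using convex_onD[OF convex, of t "axis i s" "axis i r"] t by simp
    then show "\<phi> i ((1 - t) *\<^sub>R s + t *\<^sub>R r) \<le> (1 - t) * \<phi> i s + t * \<phi> i r"
      by (simp add: section_eq algebra_simps)
  qed simp
qed

lemma subdifferential_separable:
  fixes h :: "real^'n \<Rightarrow> real"
  assumes separable: "\<And>v. h v = (\<Sum>i\<in>UNIV. \<phi> i (v $ i))"
    and "\<And>i. g $ i \<in> subdifferential (\<phi> i) (z $ i)"
  shows "g \<in> subdifferential h z"
proof -
  have "(\<Sum>i\<in>UNIV. \<phi> i (z $ i) + g $ i * (w $ i - z $ i)) \<le> (\<Sum>i\<in>UNIV. \<phi> i (w $ i))" for w
    using assms(2) by (intro sum_mono) (simp add: subdifferential_def)
  then show ?thesis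
    by (simp add: subdifferential_def separable inner_vec_def sum.distrib)
qed

text \<open>Forward substitution: once the coordinates below \<open>m\<close> are fixed, row \<open>m\<close> of the inclusion is a
  scalar problem for coordinate \<open>m\<close>, and choosing that coordinate does not disturb the earlier rows.
  The induction therefore solves the subsystem indexed by an initial segment \<open>S\<close> and adds the
  new largest index.\<close>

lemma lower_triangular_inclusion_solvable:
  fixes M :: "('n::{finite,linorder}) sqmat" and h :: "'n rvec \<Rightarrow> real"
  assumes convex: "convex_on UNIV h" and separable: "\<And>v. h v = (\<Sum>i\<in>UNIV. \<phi> i (v $ i))"
    and lower: "\<And>i j. i < j \<Longrightarrow> M $ i $ j = 0"
    and diag_pos: "\<And>i. 0 < M $ i $ i"
  obtains z where "- (M *v z + c) \<in> subdifferential h z"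
proof -
  have partial: "\<exists>z. \<forall>i\<in>S. - ((\<Sum>j\<in>S. M $ i $ j * z j) + c $ i) \<in> subdifferential (\<phi> i) (z i)"
    if "finite S" for S :: "'n set"
    using that
  proof (induction rule: finite_linorder_max_induct)
    case empty
    show ?case by simp
  next
    case (insert m S)
    then obtain z where
      z: "\<forall>i\<in>S. - ((\<Sum>j\<in>S. M $ i $ j * z j) + c $ i) \<in> subdifferential (\<phi> i) (z i)" by blast
    obtain s where
      s: "- (M $ m $ m * s + ((\<Sum>j\<in>S. M $ m $ j * z j) + c $ m)) \<in> subdifferential (\<phi> m) s"
      using scalar_resolvent_exists[OF convex_on_summand[OF convex separable] diag_pos] by metis
    have "m \<notin> S" using insert.hyps by auto
    then have sum_eq: "(\<Sum>j\<in>insert m S. M $ i $ j * (z(m := s)) j)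
        = M $ i $ m * s + (\<Sum>j\<in>S. M $ i $ j * z j)" for i
      using \<open>finite S\<close> by (simp, intro sum.cong) auto
    have "- ((\<Sum>j\<in>insert m S. M $ i $ j * (z(m := s)) j) + c $ i)
        \<in> subdifferential (\<phi> i) ((z(m := s)) i)" if "i \<in> insert m S" for i
    proof (cases "i = m")
      case True
      then show ?thesis using s unfolding sum_eq by (simp add: add.assoc)
    next
      case False
      then have "M $ i $ m = 0" using that insert.hyps by (intro lower) auto
      then show ?thesis using z False that unfolding sum_eq by auto
    qed
    then show ?case by blast
  qed
  obtain z where
    z: "\<And>i. - ((\<Sum>j\<in>UNIV. M $ i $ j * z j) + c $ i) \<in> subdifferential (\<phi> i) (z i)"
    using partial[of UNIV] by auto
  have "- (M *v vec_lambda z + c) \<in> subdifferential h (vec_lambda z)"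
    using z by (intro subdifferential_separable[where \<phi> = \<phi>, OF separable])
      (simp add: matrix_vector_mult_def)
  then show ?thesis by (rule that)
qed

section \<open>Spectral norm bounds\<close>

lemma inner_transpose_mult:
  fixes M :: "real^'m^'n"
  shows "u \<bullet> (transpose M *v v) = (M *v u) \<bullet> v"
  by (metis dot_lmul_matrix inner_commute transpose_matrix_vector)

lemma norm_mult_sq_le_spectral_norm_MtM:
  fixes M :: "real^'m^'n"
  shows "(norm (M *v v))\<^sup>2 \<le> spectral_norm (transpose M ** M) * (norm v)\<^sup>2"
proof -
  have "(norm (M *v v))\<^sup>2 = v \<bullet> ((transpose M ** M) *v v)"
    by (simp only: inner_transpose_mult power2_norm_eq_inner flip: matrix_vector_mul_assoc)
  also have "\<dots> \<le> norm v * norm ((transpose M ** M) *v v)"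
    by (rule norm_cauchy_schwarz)
  also have "\<dots> \<le> norm v * (spectral_norm (transpose M ** M) * norm v)"
    unfolding spectral_norm_def
    by (intro mult_left_mono onorm matrix_vector_mul_bounded_linear) auto
  finally show ?thesis by (simp add: power2_eq_square algebra_simps)
qed

text \<open>Obtained from the bound for the transposed matrix: by Cauchy-Schwarz,
  \<open>|M v|\<^sup>2 = \<langle>v, M\<^sup>T (M v)\<rangle> \<le> |v| |M\<^sup>T (M v)|\<close>, and the last factor is controlled by \<open>M M\<^sup>T\<close>.\<close>

lemma norm_mult_sq_le_spectral_norm_MMt:
  fixes M :: "real^'m^'n"
  shows "(norm (M *v v))\<^sup>2 \<le> spectral_norm (M ** transpose M) * (norm v)\<^sup>2"
proof (cases "M *v v = 0")
  case True
  then show ?thesis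
    by (simp add: spectral_norm_def onorm_pos_le matrix_vector_mul_bounded_linear)
next
  case False
  have "((norm (M *v v))\<^sup>2)\<^sup>2 = (v \<bullet> (transpose M *v (M *v v)))\<^sup>2"
    by (simp only: inner_transpose_mult power2_norm_eq_inner)
  also have "\<dots> \<le> (norm v * norm (transpose M *v (M *v v)))\<^sup>2"
    by (metis Cauchy_Schwarz_ineq2 abs_le_square_iff abs_norm_cancel abs_mult)
  also have "\<dots> = (norm v)\<^sup>2 * (norm (transpose M *v (M *v v)))\<^sup>2"
    by (simp add: power_mult_distrib)
  also have "\<dots> \<le> (norm v)\<^sup>2 * (spectral_norm (M ** transpose M) * (norm (M *v v))\<^sup>2)"
    using norm_mult_sq_le_spectral_norm_MtM[of "transpose M" "M *v v"]
    by (intro mult_left_mono) simp_all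
  finally have "(norm (M *v v))\<^sup>2 * (norm (M *v v))\<^sup>2
      \<le> (spectral_norm (M ** transpose M) * (norm v)\<^sup>2) * (norm (M *v v))\<^sup>2"
    by (simp add: power2_eq_square algebra_simps)
  then show ?thesis by (rule mult_right_le_imp_le) (use False in simp)
qed


section \<open>Quadratic forms of the splitting matrices\<close>

lemma splitting_decomposition:
  assumes "transpose A = A"
  shows "A = strict_lower_part A + diag_part A + transpose (strict_lower_part A)"
proof -
  have "A $ j $ i = A $ i $ j" for i j
    using assms by (metis transpose_def vec_lambda_beta)
  then show ?thesis
    by (auto simp: vec_eq_iff strict_lower_part_def diag_part_def transpose_def)
qed

lemma matB_add_matC:
  assumes "transpose A = A" and "\<omega> \<noteq> 0"
  shows "matB A \<omega> \<epsilon> + matC A \<omega> \<epsilon> = A"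
proof -
  have "1 / \<omega> + (\<omega> - 1) / \<omega> = 1"
    using \<open>\<omega> \<noteq> 0\<close> by (simp add: field_simps)
  then have "(1 / \<omega>) *\<^sub>R diag_part A + ((\<omega> - 1) / \<omega>) *\<^sub>R diag_part A = diag_part A"
    by (metis scaleR_left_distrib scaleR_one)
  then have "matB A \<omega> \<epsilon> + matC A \<omega> \<epsilon>
      = strict_lower_part A + diag_part A + transpose (strict_lower_part A)"
    by (simp add: matB_def matC_def algebra_simps)
  with splitting_decomposition[OF assms(1)] show ?thesis by simp
qed

text \<open>A triangular matrix and its transpose have the same quadratic form, so doubling the quadratic
  form of \<open>L\<close> produces the off-diagonal part of \<open>A\<close>.\<close>

lemma inner_matB:
  assumes "transpose A = A"
  shows "2 * (v \<bullet> (matB A \<omega> \<epsilon> *v v))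
    = v \<bullet> (A *v v) + (2 / \<omega> - 1) * (v \<bullet> (diag_part A *v v)) + 2 * \<epsilon> * (norm v)\<^sup>2"
proof -
  have "v \<bullet> (A *v v) = v \<bullet> (strict_lower_part A *v v) + v \<bullet> (diag_part A *v v)
      + v \<bullet> (transpose (strict_lower_part A) *v v)"
    by (subst splitting_decomposition[OF assms])
      (simp only: matrix_vector_mult_add_rdistrib inner_add_right)
  also have "v \<bullet> (transpose (strict_lower_part A) *v v) = v \<bullet> (strict_lower_part A *v v)"
    by (simp only: inner_transpose_mult inner_commute)
  finally show ?thesis
    by (simp add: matB_def matrix_vector_mult_add_rdistrib scaleR_matrix_vector_assoc[symmetric]
        inner_add_right power2_norm_eq_inner algebra_simps)
qed

lemma min_entry_le_inner_diag_part:
  fixes A :: "real^'n^'n"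
  shows "min_entry (diag_vec (diag_part A)) * (norm v)\<^sup>2 \<le> v \<bullet> (diag_part A *v v)"
proof -
  let ?m = "min_entry (diag_vec (diag_part A))"
  have entry: "?m \<le> A $ i $ i" for i
  proof -
    have "?m \<le> diag_vec (diag_part A) $ i" unfolding min_entry_def by (intro Min_le) auto
    then show ?thesis by (simp add: diag_vec_def diag_part_def)
  qed
  have "?m * (norm v)\<^sup>2 = (\<Sum>i\<in>UNIV. ?m * (v $ i * v $ i))"
    by (simp add: power2_norm_eq_inner inner_vec_def sum_distrib_left)
  also have "\<dots> \<le> (\<Sum>i\<in>UNIV. A $ i $ i * (v $ i * v $ i))"
    by (intro sum_mono mult_right_mono entry) auto
  also have "\<dots> = v \<bullet> (diag_part A *v v)"
    by (simp add: inner_vec_def matrix_vector_mult_def diag_part_def if_distrib[of "\<lambda>a. a * _"]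
        cong: if_cong) (simp add: mult_ac)
  finally show ?thesis .
qed

lemma sq_norm_wrt_matQ:
  "sq_norm_wrt (matQ A \<omega> \<epsilon>) v = 2 * (v \<bullet> (matB A \<omega> \<epsilon> *v v)) - 1 / 2 * (v \<bullet> (A *v v))"
  by (simp add: sq_norm_wrt_def matQ_def matrix_vector_mult_diff_rdistrib
      scaleR_matrix_vector_assoc[symmetric] inner_diff_right)

lemma sq_norm_wrt_matP:
  "sq_norm_wrt (matP A \<omega> \<epsilon>) v = 2 * (norm (matB A \<omega> \<epsilon> *v v))\<^sup>2"
  by (simp only: sq_norm_wrt_def matP_def scaleR_matrix_vector_assoc[symmetric] inner_scaleR_right
      inner_transpose_mult power2_norm_eq_inner flip: matrix_vector_mul_assoc)

lemma sq_norm_wrt_matG: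
  "sq_norm_wrt (matG A \<omega> \<epsilon> a) v
    = a\<^sup>2 * (norm (matB A \<omega> \<epsilon> *v v))\<^sup>2 - a * sq_norm_wrt (matQ A \<omega> \<epsilon>) v"
proof -
  have "sq_norm_wrt (matG A \<omega> \<epsilon> a) v
      = 1 / 2 * a\<^sup>2 * sq_norm_wrt (matP A \<omega> \<epsilon>) v - a * sq_norm_wrt (matQ A \<omega> \<epsilon>) v"
    by (simp add: sq_norm_wrt_def matG_def matrix_vector_mult_diff_rdistrib
      scaleR_matrix_vector_assoc[symmetric] inner_diff_right)
  then show ?thesis by (simp add: sq_norm_wrt_matP)
qed

text \<open>The half of \<open>A\<close> subtracted in \<open>Q\<close> still leaves the positive semidefinite \<open>A / 2\<close> in its
  quadratic form; the remaining diagonal terms are bounded below entrywise, which is where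
  \<open>\<delta>\<close> comes from.\<close>

lemma splitting_delta_le_matQ:
  assumes sym: "transpose A = A" and psd: "positive_semidefinite A" and "0 < \<omega>" "\<omega> < 2"
  shows "splitting_delta A \<omega> \<epsilon> * (norm v)\<^sup>2 \<le> sq_norm_wrt (matQ A \<omega> \<epsilon>) v"
proof -
  have "splitting_delta A \<omega> \<epsilon> * (norm v)\<^sup>2
      = 2 * \<epsilon> * (norm v)\<^sup>2
        + (2 - \<omega>) / \<omega> * (min_entry (diag_vec (diag_part A)) * (norm v)\<^sup>2)"
    by (simp add: splitting_delta_def algebra_simps)
  also have "\<dots> \<le> 2 * \<epsilon> * (norm v)\<^sup>2 + (2 - \<omega>) / \<omega> * (v \<bullet> (diag_part A *v v))"
    using assms(3,4) by (intro add_left_mono mult_left_mono min_entry_le_inner_diag_part) auto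
  also have "\<dots> = sq_norm_wrt (matQ A \<omega> \<epsilon>) v - 1 / 2 * (v \<bullet> (A *v v))"
    using \<open>0 < \<omega>\<close> by (simp add: sq_norm_wrt_matQ inner_matB[OF sym] diff_divide_distrib)
  also have "\<dots> \<le> sq_norm_wrt (matQ A \<omega> \<epsilon>) v"
    using psd by (simp add: positive_semidefinite_def)
  finally show ?thesis .
qed

lemma inner_matB_pos:
  assumes "transpose A = A" and psd: "positive_semidefinite A" and "0 < \<omega>" "\<omega> < 2"
    and "0 < splitting_delta A \<omega> \<epsilon>" and "v \<noteq> 0"
  shows "0 < v \<bullet> (matB A \<omega> \<epsilon> *v v)"
proof -
  have "0 < splitting_delta A \<omega> \<epsilon> * (norm v)\<^sup>2" using assms by simp
  also have "\<dots> \<le> sq_norm_wrt (matQ A \<omega> \<epsilon>) v"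
    using assms by (intro splitting_delta_le_matQ)
  also have "\<dots> \<le> 2 * (v \<bullet> (matB A \<omega> \<epsilon> *v v))"
    using psd by (simp add: sq_norm_wrt_matQ positive_semidefinite_def)
  finally show ?thesis by simp
qed

section \<open>The splitting map and the optimality condition\<close>

text \<open>Strict positivity of the quadratic form of \<open>B\<close> against monotonicity of the subdifferential
  forces two solutions to coincide, so the definite description in the splitting map denotes the
  solution found by forward substitution. Since \<open>C = A - B\<close>, the inclusion can be read as a formula
  for \<open>B\<close> applied to the residual.\<close>

lemma splitting_map_inclusion:
  fixes A :: "('n::{finite,linorder}) sqmat" and h :: "'n rvec \<Rightarrow> real"
  assumes sym: "transpose A = A" and "positive_semidefinite A"
    and convex: "convex_on UNIV h" and separable: "\<And>v. h v = (\<Sum>i\<in>UNIV. \<phi> i (v $ i))"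
    and "0 < \<omega>" "\<omega> < 2"
    and diag_pos: "\<And>i. 0 < matB A \<omega> \<epsilon> $ i $ i"
    and "0 < splitting_delta A \<omega> \<epsilon>"
  obtains g where "g \<in> subdifferential h (splitting_map A b h \<omega> \<epsilon> x)"
    and "matB A \<omega> \<epsilon> *v (splitting_map A b h \<omega> \<epsilon> x - x) = - (A *v x + b + g)"
proof -
  let ?B = "matB A \<omega> \<epsilon>" and ?C = "matC A \<omega> \<epsilon>"
  define solves where "solves z \<longleftrightarrow> - (?B *v z + (?C *v x + b)) \<in> subdifferential h z" for z
  have zero_iff: "0 \<in> (\<lambda>g. r + g) ` S \<longleftrightarrow> - r \<in> S" for r :: "'n rvec" and S
  proof
    assume "0 \<in> (\<lambda>g. r + g) ` S"
    then obtain g where "g \<in> S" "r + g = 0" by (metis imageE)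
    then show "- r \<in> S" using add_eq_0_iff[of r g] by simp
  qed (auto intro: image_eqI[of _ _ "- r"])
  have inclusion_iff: "0 \<in> (\<lambda>g. ?B *v z + ?C *v x + b + g) ` subdifferential h z \<longleftrightarrow> solves z" for z
    unfolding zero_iff solves_def by (simp only: add.assoc)
  have "?B $ i $ j = 0" if "i < j" for i j
    using that by (auto simp: matB_def strict_lower_part_def diag_part_def mat_def)
  from lower_triangular_inclusion_solvable[OF convex separable this diag_pos]
  obtain z where z: "solves z" unfolding solves_def .
  have unique: "z' = z" if "solves z'" for z'
  proof (rule ccontr)
    assume "z' \<noteq> z"
    then have "0 < (z' - z) \<bullet> (?B *v (z' - z))"
      using assms by (intro inner_matB_pos) auto
    moreover have "0 \<le> (- (?B *v z' + (?C *v x + b)) - - (?B *v z + (?C *v x + b))) \<bullet> (z' - z)"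
      using that z unfolding solves_def by (rule subdifferential_monotone)
    moreover have "(- (?B *v z' + (?C *v x + b)) - - (?B *v z + (?C *v x + b))) \<bullet> (z' - z)
        = - ((z' - z) \<bullet> (?B *v (z' - z)))"
      unfolding inner_commute[of "z' - z"] inner_minus_left[symmetric]
      by (simp add: matrix_vector_mult_diff_distrib)
    ultimately show False by linarith
  qed
  have map_eq: "splitting_map A b h \<omega> \<epsilon> x = z"
    unfolding splitting_map_def inclusion_iff using z unique by (rule the_equality)
  have "?B *v x + ?C *v x = A *v x"
    using matB_add_matC[OF sym, of \<omega> \<epsilon>] \<open>0 < \<omega>\<close>
    by (simp flip: matrix_vector_mult_add_rdistrib)
  then have "?B *v (z - x) = - (A *v x + b + - (?B *v z + (?C *v x + b)))"
    by (simp add: matrix_vector_mult_diff_distrib flip: \<open>_ = A *v x\<close>)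
  with z show ?thesis using that unfolding map_eq solves_def by blast
qed

text \<open>Both directions serve: the reference minimizer supplies a subgradient, and a fixed point of the
  splitting map, where this inclusion holds, is a minimizer. Sufficiency rests on a convex quadratic
  lying above its linearization at \<open>z\<close>.\<close>

lemma objective_minimizer_iff:
  assumes sym: "transpose A = A" and psd: "positive_semidefinite A"
    and convex: "convex_on UNIV h"
  shows "is_arg_min (objective A b h) (\<lambda>_. True) z \<longleftrightarrow> - (A *v z + b) \<in> subdifferential h z"
proof -
  have sym_inner: "u \<bullet> (A *v w) = w \<bullet> (A *v u)" for u w
    using inner_transpose_mult[of u A w] unfolding sym by (simp add: inner_commute)
  define q where "q v = 1 / 2 * (v \<bullet> (A *v v)) + v \<bullet> b" for v
  have objective_eq: "objective A b h v = q v + h v" for v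
    by (simp add: objective_def q_def)
  have expansion: "q (z + t *\<^sub>R (w - z))
      = q z + t * ((A *v z + b) \<bullet> (w - z)) + t\<^sup>2 * (1 / 2 * ((w - z) \<bullet> (A *v (w - z))))" for t w
  proof -
    have "q (z + t *\<^sub>R d)
        = q z + t * ((A *v z + b) \<bullet> d) + t\<^sup>2 * (1 / 2 * (d \<bullet> (A *v d)))" for d
      by (simp add: q_def matrix_vector_right_distrib matrix_vector_mult_scaleR inner_add_left
          inner_add_right sym_inner[of z d] inner_commute[of _ d] power2_eq_square algebra_simps)
    then show ?thesis .
  qed
  show ?thesis
  proof
    assume "is_arg_min (objective A b h) (\<lambda>_. True) z"
    then have minimal: "q z + h z \<le> q v + h v" for v
      by (simp add: is_arg_min_linorder objective_eq)
    have "h z - (A *v z + b) \<bullet> (w - z) \<le> h w" for w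
      by (rule subgradient_inequality_at_minimizer[OF convex minimal expansion])
    then show "- (A *v z + b) \<in> subdifferential h z"
      by (simp add: subdifferential_def inner_add_left algebra_simps)
  next
    assume sub: "- (A *v z + b) \<in> subdifferential h z"
    have "q z + h z \<le> q v + h v" for v
    proof -
      have "q v = q z + (A *v z + b) \<bullet> (v - z) + 1 / 2 * ((v - z) \<bullet> (A *v (v - z)))"
        using expansion[of 1 v] by simp
      moreover have "0 \<le> (v - z) \<bullet> (A *v (v - z))"
        using psd by (simp add: positive_semidefinite_def)
      moreover have "h z - (A *v z + b) \<bullet> (v - z) \<le> h v"
        using sub unfolding subdifferential_def mem_Collect_eq inner_minus_left
        by (simp only: diff_conv_add_uminus)
      ultimately show ?thesis by linarith
    qed
    then show "is_arg_min (objective A b h) (\<lambda>_. True) z"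
      by (simp add: is_arg_min_linorder objective_eq)
  qed
qed

section \<open>Change of the distance to a minimizer\<close>

text \<open>The comparison with the minimizer \<open>xs\<close>. Monotonicity removes the subgradients, leaving
  \<open>- \<langle>A u, u + d\<rangle>\<close> with \<open>u = x - xs\<close> and \<open>d = y - x\<close>; as a function of the unknown \<open>u\<close> this is largest
  at \<open>u = - d/2\<close>, which explains the factor \<open>1/4\<close>.\<close>

lemma monotone_psd_pairing_bound:
  fixes A :: "real^'n^'n"
  assumes sym: "transpose A = A" and psd: "positive_semidefinite A"
    and g: "g \<in> subdifferential h y"
    and gs: "- (A *v xs + b) \<in> subdifferential h xs"
    and r: "r = - (A *v x + b + g)"
  shows "r \<bullet> (y - xs) \<le> 1 / 4 * ((y - x) \<bullet> (A *v (y - x)))"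
proof -
  define d u where "d = y - x" and "u = x - xs"
  have sym_inner: "u \<bullet> (A *v d) = d \<bullet> (A *v u)"
    using inner_transpose_mult[of u A d] unfolding sym by (simp add: inner_commute)
  have "r = - (A *v u) - (g - - (A *v xs + b))"
    by (simp add: r u_def matrix_vector_mult_diff_distrib)
  then have "r \<bullet> (y - xs) = - ((A *v u) \<bullet> (u + d)) - (g - - (A *v xs + b)) \<bullet> (y - xs)"
    by (simp add: u_def d_def inner_diff_left)
  also have "\<dots> \<le> - ((A *v u) \<bullet> (u + d))"
    using subdifferential_monotone[OF g gs] by simp
  also have "\<dots> = 1 / 4 * (d \<bullet> (A *v d))
      - (u + (1 / 2) *\<^sub>R d) \<bullet> (A *v (u + (1 / 2) *\<^sub>R d))"
    by (simp add: matrix_vector_right_distrib matrix_vector_mult_scaleR inner_add_left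
        inner_add_right sym_inner inner_commute[of "A *v u"] algebra_simps)
  also have "\<dots> \<le> 1 / 4 * (d \<bullet> (A *v d))"
    using psd by (simp add: positive_semidefinite_def)
  finally show ?thesis by (simp add: d_def)
qed

lemma distance_change_le_matG:
  assumes pairing: "(matB A \<omega> \<epsilon> *v d) \<bullet> (x + d - xs) \<le> 1 / 4 * (d \<bullet> (A *v d))"
    and "0 \<le> a"
  shows "(norm (x + a *\<^sub>R (matB A \<omega> \<epsilon> *v d) - xs))\<^sup>2 - (norm (x - xs))\<^sup>2
    \<le> sq_norm_wrt (matG A \<omega> \<epsilon> a) d"
proof -
  let ?r = "matB A \<omega> \<epsilon> *v d"
  have "2 * (?r \<bullet> (x - xs)) \<le> - sq_norm_wrt (matQ A \<omega> \<epsilon>) d"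
    using pairing by (simp add: sq_norm_wrt_matQ inner_diff_right inner_add_right inner_commute[of d])
  then have "a * (2 * (?r \<bullet> (x - xs))) \<le> a * - sq_norm_wrt (matQ A \<omega> \<epsilon>) d"
    using \<open>0 \<le> a\<close> by (rule mult_left_mono)
  moreover have "(norm (x + a *\<^sub>R ?r - xs))\<^sup>2 - (norm (x - xs))\<^sup>2
      = a * (2 * (?r \<bullet> (x - xs))) + a\<^sup>2 * (norm ?r)\<^sup>2"
    using dot_norm[of "a *\<^sub>R ?r" "x - xs"] by (simp add: power_mult_distrib algebra_simps)
  ultimately show ?thesis by (simp add: sq_norm_wrt_matG)
qed

section \<open>Step sizes\<close>

lemma negative_definite_matG:
  fixes A :: "('n::{finite,linorder}) sqmat"
  assumes "transpose A = A" "positive_semidefinite A" "0 < \<omega>" "\<omega> < 2"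
    and "0 < splitting_delta A \<omega> \<epsilon>" and a: "0 < a"
    and a_less: "a < splitting_delta A \<omega> \<epsilon>
      / spectral_norm (transpose (matB A \<omega> \<epsilon>) ** matB A \<omega> \<epsilon>)"
  shows "negative_definite (matG A \<omega> \<epsilon> a)"
  unfolding negative_definite_def
proof (intro allI impI)
  fix v :: "'n rvec" assume "v \<noteq> 0"
  let ?N = "spectral_norm (transpose (matB A \<omega> \<epsilon>) ** matB A \<omega> \<epsilon>)"
  have "0 \<le> ?N" by (simp add: spectral_norm_def onorm_pos_le)
  \<comment> \<open>Division by zero yields zero, so the bound on the positive step excludes \<open>?N = 0\<close>.\<close>
  moreover have "?N \<noteq> 0" using a a_less by auto
  ultimately have small: "a * ?N < splitting_delta A \<omega> \<epsilon>"
    using a_less by (simp add: pos_less_divide_eq)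
  have "sq_norm_wrt (matG A \<omega> \<epsilon> a) v
      \<le> a\<^sup>2 * (?N * (norm v)\<^sup>2) - a * (splitting_delta A \<omega> \<epsilon> * (norm v)\<^sup>2)"
    unfolding sq_norm_wrt_matG using assms
    by (intro diff_mono mult_left_mono norm_mult_sq_le_spectral_norm_MtM splitting_delta_le_matQ) auto
  also have "\<dots> = a * (norm v)\<^sup>2 * (a * ?N - splitting_delta A \<omega> \<epsilon>)"
    by (simp add: power2_eq_square algebra_simps)
  also have "\<dots> < 0"
    using a \<open>v \<noteq> 0\<close> small by (intro mult_pos_neg) auto
  finally show "v \<bullet> (matG A \<omega> \<epsilon> a *v v) < 0" by (simp add: sq_norm_wrt_def)
qed

text \<open>As a function of the step, the quadratic form of \<open>G\<close> at \<open>v\<close> is a parabola through the origin and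
  \<open>a\<close> is its vertex, with value \<open>- \<langle>v, Q v\<rangle>\<^sup>2 / (4 |B v|\<^sup>2)\<close>. Bounding numerator and denominator
  separately gives the estimate.\<close>

lemma matG_optimal_step:
  assumes "transpose A = A" "positive_semidefinite A" "0 < \<omega>" "\<omega> < 2"
    and delta: "0 < splitting_delta A \<omega> \<epsilon>" and "v \<noteq> 0"
    and a: "a = sq_norm_wrt (matQ A \<omega> \<epsilon>) v / sq_norm_wrt (matP A \<omega> \<epsilon>) v"
  defines "bound \<equiv> (splitting_delta A \<omega> \<epsilon>)\<^sup>2 * (norm v)\<^sup>2
    / (4 * spectral_norm (matB A \<omega> \<epsilon> ** transpose (matB A \<omega> \<epsilon>)))"
  shows "sq_norm_wrt (matG A \<omega> \<epsilon> a) v \<le> - bound" and "0 < bound"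
proof -
  let ?N = "spectral_norm (matB A \<omega> \<epsilon> ** transpose (matB A \<omega> \<epsilon>))"
    and ?\<delta> = "splitting_delta A \<omega> \<epsilon>" and ?Q = "sq_norm_wrt (matQ A \<omega> \<epsilon>) v"
  define s where "s = (norm (matB A \<omega> \<epsilon> *v v))\<^sup>2"
  have step_eq: "a = ?Q / (2 * s)" by (simp add: a sq_norm_wrt_matP s_def)
  have "0 < v \<bullet> (matB A \<omega> \<epsilon> *v v)" using assms by (intro inner_matB_pos)
  then have "0 < s" by (auto simp: s_def)
  have s_le: "s \<le> ?N * (norm v)\<^sup>2"
    unfolding s_def by (rule norm_mult_sq_le_spectral_norm_MMt)
  have "0 < (norm v)\<^sup>2" using \<open>v \<noteq> 0\<close> by simp
  with \<open>0 < s\<close> s_le have "0 < ?N"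
    by (meson less_le_trans zero_less_mult_pos2)
  with delta \<open>v \<noteq> 0\<close> show "0 < bound" by (simp add: bound_def)
  have "(?\<delta> * (norm v)\<^sup>2)\<^sup>2 \<le> ?Q\<^sup>2"
    using assms by (intro power_mono splitting_delta_le_matQ) auto
  moreover have "bound * (4 * s) \<le> bound * (4 * (?N * (norm v)\<^sup>2))"
    using s_le \<open>0 < bound\<close> by (intro mult_left_mono) auto
  moreover have "bound * (4 * (?N * (norm v)\<^sup>2)) = (?\<delta> * (norm v)\<^sup>2)\<^sup>2"
    using \<open>0 < ?N\<close> by (simp add: bound_def power2_eq_square)
  ultimately have "bound \<le> ?Q\<^sup>2 / (4 * s)"
    using \<open>0 < s\<close> by (simp add: pos_le_divide_eq)
  moreover have "sq_norm_wrt (matG A \<omega> \<epsilon> a) v = - (?Q\<^sup>2 / (4 * s))"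
    using \<open>0 < s\<close> unfolding sq_norm_wrt_matG s_def[symmetric]
    by (simp add: step_eq power2_eq_square field_simps)
  ultimately show "sq_norm_wrt (matG A \<omega> \<epsilon> a) v \<le> - bound" by simp
qed

theorem theorem5:
  fixes A :: "('n::{finite,linorder}) sqmat"
    and b :: "'n rvec"
    and h :: "'n rvec \<Rightarrow> real"
    and h\<^sub>i :: "'n \<Rightarrow> real \<Rightarrow> real"
    and \<omega> \<epsilon> :: real
    and xstar :: "'n rvec"
    and x y :: "nat \<Rightarrow> 'n rvec"
    and \<alpha> :: "nat \<Rightarrow> real"
    and k :: nat
  assumes A_sym: "transpose A = A"
    and A_psd: "positive_semidefinite A"
    and h_convex: "convex_on UNIV h"
    and h_separable: "\<And>v. h v = (\<Sum>i\<in>UNIV. h\<^sub>i i (v $ i))"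
    and f_bdd_below: "bdd_below (range (objective A b h))"
    and omega: "0 < \<omega>" "\<omega> < 2"
    and epsilon: "0 \<le> \<epsilon>"
    and B_diag_pos: "\<And>i. 0 < matB A \<omega> \<epsilon> $ i $ i"
    and delta_pos: "0 < splitting_delta A \<omega> \<epsilon>"
    and xstar_min: "is_arg_min (objective A b h) (\<lambda>_. True) xstar"
    and alpha_pos: "\<And>j. 0 < \<alpha> j"
    and y_def: "\<And>j. y j = splitting_map A b h \<omega> \<epsilon> (x j)"
    and x_step: "\<And>j. x (Suc j) = x j + \<alpha> j *\<^sub>R (matB A \<omega> \<epsilon> *v (y j - x j))"
    and xk_not_min: "\<not> is_arg_min (objective A b h) (\<lambda>_. True) (x k)"
  shows "(norm (x (Suc k) - xstar))\<^sup>2 - (norm (x k - xstar))\<^sup>2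
           \<le> sq_norm_wrt (matG A \<omega> \<epsilon> (\<alpha> k)) (y k - x k)
       \<and>
         (0 < \<alpha> k \<and>
          \<alpha> k < splitting_delta A \<omega> \<epsilon>
                  / spectral_norm (transpose (matB A \<omega> \<epsilon>) ** matB A \<omega> \<epsilon>)
          \<longrightarrow>
          negative_definite (matG A \<omega> \<epsilon> (\<alpha> k)) \<and>
          (norm (x (Suc k) - xstar))\<^sup>2 - (norm (x k - xstar))\<^sup>2 < 0)
       \<and>
         (\<alpha> k = sq_norm_wrt (matQ A \<omega> \<epsilon>) (y k - x k)
                  / sq_norm_wrt (matP A \<omega> \<epsilon>) (y k - x k)
          \<longrightarrow>
          (norm (x (Suc k) - xstar))\<^sup>2 - (norm (x k - xstar))\<^sup>2
            \<le> - ((splitting_delta A \<omega> \<epsilon>)\<^sup>2 * (norm (y k - x k))\<^sup>2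
                  / (4 * spectral_norm (matB A \<omega> \<epsilon> ** transpose (matB A \<omega> \<epsilon>)))) \<and>
          - ((splitting_delta A \<omega> \<epsilon>)\<^sup>2 * (norm (y k - x k))\<^sup>2
              / (4 * spectral_norm (matB A \<omega> \<epsilon> ** transpose (matB A \<omega> \<epsilon>)))) < 0)"
proof -
  define d where "d = y k - x k"
  obtain g where g: "g \<in> subdifferential h (y k)"
    and step: "matB A \<omega> \<epsilon> *v d = - (A *v x k + b + g)"
    unfolding d_def y_def
    by (rule splitting_map_inclusion[OF A_sym A_psd h_convex h_separable omega B_diag_pos delta_pos])
  \<comment> \<open>A vanishing residual would make the iterate a fixed point, hence a minimizer.\<close>
  have "d \<noteq> 0"
  proof
    assume "d = 0"
    then have "y k = x k" by (simp add: d_def)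
    moreover have "A *v x k + b + g = 0"
      using step \<open>d = 0\<close> by (simp only: matrix_vector_mult_0_right neg_0_equal_iff_equal)
    then have "g = - (A *v x k + b)" by (simp only: add_eq_0_iff)
    ultimately have "- (A *v x k + b) \<in> subdifferential h (x k)" using g by simp
    with xk_not_min show False
      using objective_minimizer_iff[OF A_sym A_psd h_convex] by blast
  qed
  have "(matB A \<omega> \<epsilon> *v d) \<bullet> (y k - xstar) \<le> 1 / 4 * (d \<bullet> (A *v d))"
    unfolding d_def
    using monotone_psd_pairing_bound[OF A_sym A_psd g _ step[unfolded d_def]]
      xstar_min objective_minimizer_iff[OF A_sym A_psd h_convex] by metis
  then have descent: "(norm (x (Suc k) - xstar))\<^sup>2 - (norm (x k - xstar))\<^sup>2
      \<le> sq_norm_wrt (matG A \<omega> \<epsilon> (\<alpha> k)) d"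
    using distance_change_le_matG[where d = d and x = "x k" and a = "\<alpha> k"] alpha_pos[of k]
    by (simp add: x_step d_def)
  have global_constant: "negative_definite (matG A \<omega> \<epsilon> (\<alpha> k)) \<and>
      (norm (x (Suc k) - xstar))\<^sup>2 - (norm (x k - xstar))\<^sup>2 < 0"
    if "\<alpha> k < splitting_delta A \<omega> \<epsilon>
      / spectral_norm (transpose (matB A \<omega> \<epsilon>) ** matB A \<omega> \<epsilon>)"
  proof -
    have negdef: "negative_definite (matG A \<omega> \<epsilon> (\<alpha> k))"
      by (rule negative_definite_matG[OF A_sym A_psd omega delta_pos alpha_pos that])
    then have "sq_norm_wrt (matG A \<omega> \<epsilon> (\<alpha> k)) d < 0"
      using \<open>d \<noteq> 0\<close> by (simp add: negative_definite_def sq_norm_wrt_def)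
    with descent negdef show ?thesis by linarith
  qed
  have local_constant: "(norm (x (Suc k) - xstar))\<^sup>2 - (norm (x k - xstar))\<^sup>2
      \<le> - ((splitting_delta A \<omega> \<epsilon>)\<^sup>2 * (norm d)\<^sup>2
            / (4 * spectral_norm (matB A \<omega> \<epsilon> ** transpose (matB A \<omega> \<epsilon>)))) \<and>
      - ((splitting_delta A \<omega> \<epsilon>)\<^sup>2 * (norm d)\<^sup>2
          / (4 * spectral_norm (matB A \<omega> \<epsilon> ** transpose (matB A \<omega> \<epsilon>)))) < 0"
    if "\<alpha> k = sq_norm_wrt (matQ A \<omega> \<epsilon>) d / sq_norm_wrt (matP A \<omega> \<epsilon>) d"
    using descent matG_optimal_step[OF A_sym A_psd omega delta_pos \<open>d \<noteq> 0\<close> that] by linarith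
  show ?thesis
    using descent global_constant local_constant unfolding d_def by blast
qed

end
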